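(* There exists a subgroup $L$ of the mother group $G_3$ which is isomorphic to the direct sum of (countably) infinitely many copies of $\mathbb{Z}$, i.e. $L\cong\bigoplus_{\infty}\mathbb{Z}$.
   Context: Rooted trees. Let $X=\{1,2,3\}$, and let $X^*$ be the set of finite words over $X$ (including the empty word $\emptyset$), viewed as the vertex set of the 3-regular rooted tree $T_3$ with root $\emptyset$, where $w$ and $wx$ are joined by an edge for $w\in X^*$, $x\in X$. $\mathrm{Aut}(T_3)=\mathrm{Aut}(X^* )$ is the group of bijections of $X^*$ preserving the root and adjacency. For $g\in\mathrm{Aut}(X^* )$ and $v\in X^*$, the restriction $g|_v$ is defined by $g(vw)=g(v)\,g|_v(w)$ for all $w\in X^*$. One writes $g=(g|_1,g|_2,g|_3)\sigma$, where $\sigma\in S_3$ is the action of $g$ on the first level $X$. Multiplication is $(g_1,g_2,g_3)\sigma\cdot(h_1,h_2,h_3)\tau=(g_1h_{\sigma(1)},g_2h_{\sigma(2)},g_3h_{\sigma(3)})\sigma\tau$; products of permutations and of automorphisms are read from left to right ($gh$ means first $g$, then $h$). Mother group $G_3$. Each $a\in S_3$ is regarded as the automorphism $a=(1,1,1)a$. Let $B_3=S_3\wr 2=S_3^2\rtimes S_2$; each $b=(b_1,b_2)\sigma\in B_3$ (with $b_1,b_2\in S_3$, $\sigma\in S_2$ acting on $\{1,2\}$ and extended to fix $3$) is regarded as the automorphism of $T_3$ defined recursively by $b=(b_1,b_2,b)\sigma$. $G_3$ is the subgroup of $\mathrm{Aut}(T_3)$ generated by the images of $S_3$ and $B_3$.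 *)

theory Defs
  imports
    "HOL-Combinatorics.Permutations"
    "HOL-Algebra.Elementary_Groups"
    "HOL-Algebra.Product_Groups"
begin

text \<open>The alphabet \<open>X = {1,2,3}\<close> is a three-element type, so that \<open>X\<^sup>*\<close> is the whole
  type of lists over it and automorphisms of the tree need no restriction to a carrier.\<close>

datatype letter = L1 | L2 | L3

type_synonym vertex = "letter list"

definition adjacent :: "vertex \<Rightarrow> vertex \<Rightarrow> bool" where
  "adjacent u v \<longleftrightarrow> (\<exists>x. v = u @ [x] \<or> u = v @ [x])"

text \<open>Products are read from left to right: \<open>gh\<close> means first \<open>g\<close>, then \<open>h\<close>.\<close>

definition tree_aut :: "(vertex \<Rightarrow> vertex) monoid" where
  "tree_aut =
    \<lparr>carrier = {g. bij g \<and> g [] = [] \<and> (\<forall>u v. adjacent (g u) (g v) \<longleftrightarrow> adjacent u v)},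
     mult = (\<lambda>g h. h \<circ> g),
     one = id\<rparr>"

text \<open>\<open>a = (1,1,1)a\<close>\<close>

fun rooted_aut :: "(letter \<Rightarrow> letter) \<Rightarrow> vertex \<Rightarrow> vertex" where
  "rooted_aut a [] = []"
| "rooted_aut a (x # w) = a x # w"

text \<open>\<open>b = (b\<^sub>1,b\<^sub>2,b)\<sigma>\<close>, unfolded by \<open>b (xw) = \<sigma>(x) b|\<^sub>x(w)\<close>\<close>

fun directed_aut ::
  "(letter \<Rightarrow> letter) \<Rightarrow> (letter \<Rightarrow> letter) \<Rightarrow> (letter \<Rightarrow> letter) \<Rightarrow> vertex \<Rightarrow> vertex"
where
  "directed_aut b1 b2 \<sigma> [] = []"
| "directed_aut b1 b2 \<sigma> (L1 # w) = \<sigma> L1 # rooted_aut b1 w"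
| "directed_aut b1 b2 \<sigma> (L2 # w) = \<sigma> L2 # rooted_aut b2 w"
| "directed_aut b1 b2 \<sigma> (L3 # w) = \<sigma> L3 # directed_aut b1 b2 \<sigma> w"

definition S3 :: "(letter \<Rightarrow> letter) set" where
  "S3 = {a. a permutes {L1, L2, L3}}"

text \<open>\<open>S\<^sub>2\<close> acting on \<open>{1,2}\<close>; \<open>permutes\<close> includes the extension fixing \<open>3\<close>.\<close>

definition S2 :: "(letter \<Rightarrow> letter) set" where
  "S2 = {\<sigma>. \<sigma> permutes {L1, L2}}"

text \<open>Only the underlying set \<open>S\<^sub>3 \<times> S\<^sub>3 \<times> S\<^sub>2\<close> of the wreath product \<open>B\<^sub>3\<close> matters for the
  subgroup generated by its image.\<close>

definition mother_generators :: "(vertex \<Rightarrow> vertex) set" where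
  "mother_generators =
    rooted_aut ` S3 \<union> {directed_aut b1 b2 \<sigma> | b1 b2 \<sigma>. b1 \<in> S3 \<and> b2 \<in> S3 \<and> \<sigma> \<in> S2}"

definition mother_group :: "(vertex \<Rightarrow> vertex) monoid" where
  "mother_group = subgroup_generated tree_aut mother_generators"

text \<open>\<^const>\<open>subgroup_generated\<close> silently intersects the generating set with the carrier;
  the following facts show that nothing is lost.\<close>

lemma group_tree_aut: "group tree_aut"
proof (rule groupI)
  fix g assume g: "g \<in> carrier tree_aut"
  then have b: "bij g" and r: "g [] = []"
    and a: "\<And>u v. adjacent (g u) (g v) \<longleftrightarrow> adjacent u v"
    by (auto simp: tree_aut_def)
  have "adjacent (inv_into UNIV g u) (inv_into UNIV g v) \<longleftrightarrow> adjacent u v" for u v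
    using a[of "inv_into UNIV g u" "inv_into UNIV g v"] b by (simp add: bij_is_surj surj_f_inv_f)
  moreover have "inv_into UNIV g [] = []"
    using b r by (metis bij_inv_eq_iff)
  ultimately have "inv_into UNIV g \<in> carrier tree_aut"
    using b by (simp add: tree_aut_def bij_imp_bij_inv)
  moreover have "inv_into UNIV g \<otimes>\<^bsub>tree_aut\<^esub> g = \<one>\<^bsub>tree_aut\<^esub>"
    using b by (simp add: tree_aut_def fun_eq_iff bij_is_surj surj_f_inv_f)
  ultimately show "\<exists>h\<in>carrier tree_aut. h \<otimes>\<^bsub>tree_aut\<^esub> g = \<one>\<^bsub>tree_aut\<^esub>" by blast
qed (auto simp: tree_aut_def bij_comp o_assoc)

lemma tree_autI:
  assumes "g \<circ> h = id" "h \<circ> g = id" "g [] = []"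
    and g: "\<And>u x. \<exists>y. g (u @ [x]) = g u @ [y]" and h: "\<And>u x. \<exists>y. h (u @ [x]) = h u @ [y]"
  shows "g \<in> carrier tree_aut"
proof -
  have hg: "h (g u) = u" for u using assms(2) by (simp add: fun_eq_iff)
  have G: "adjacent (g u) (g v)" if "adjacent u v" for u v
    using that g by (auto simp: adjacent_def)
  have H: "adjacent (h u) (h v)" if "adjacent u v" for u v
    using that h by (auto simp: adjacent_def)
  have "adjacent (g u) (g v) \<longleftrightarrow> adjacent u v" for u v
    using G H[of "g u" "g v"] hg by auto
  then show ?thesis
    using assms by (simp add: tree_aut_def o_bij)
qed

lemma rooted_aut_snoc: "\<exists>y. rooted_aut a (u @ [x]) = rooted_aut a u @ [y]"
  by (cases u) auto

lemma directed_aut_snoc: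
  "\<exists>y. directed_aut b1 b2 \<sigma> (u @ [x]) = directed_aut b1 b2 \<sigma> u @ [y]"
proof (induction u)
  case Nil
  show ?case by (cases x) auto
next
  case (Cons z u)
  then show ?case by (cases z) (auto simp: rooted_aut_snoc)
qed

lemma rooted_aut_inv:
  assumes "\<And>x. a' (a x) = x"
  shows "rooted_aut a' (rooted_aut a w) = w"
  using assms by (cases w) auto

lemma directed_aut_inv:
  assumes s: "\<And>x. \<sigma>' (\<sigma> x) = x" "\<sigma> L3 = L3"
    and b: "\<And>i x. c' (\<sigma> i) (c i x) = x"
  shows "directed_aut (c' L1) (c' L2) \<sigma>' (directed_aut (c L1) (c L2) \<sigma> w) = w"
proof (induction w)
  case (Cons x w)
  show ?case
  proof (cases "x = L3")
    case True
    then show ?thesis using Cons s(1)[of L3] s(2) by simp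
  next
    case False
    have n: "\<sigma> x \<noteq> L3" using s False by metis
    have R: "rooted_aut (c' (\<sigma> x)) (rooted_aut (c x) w) = w"
      by (rule rooted_aut_inv) (rule b)
    show ?thesis
      using R False n s(1)[of x] by (cases x; cases "\<sigma> x") auto
  qed
qed auto

lemma mother_generators_subset: "mother_generators \<subseteq> carrier tree_aut"
proof -
  have "rooted_aut a \<in> carrier tree_aut" if "a \<in> S3" for a
    using that permutes_inverses[of a]
    by (intro tree_autI[where h = "rooted_aut (inv_into UNIV a)"])
      (auto simp: S3_def fun_eq_iff rooted_aut_inv rooted_aut_snoc)
  moreover have "directed_aut b1 b2 \<sigma> \<in> carrier tree_aut"
    if b: "b1 \<in> S3" "b2 \<in> S3" and s: "\<sigma> \<in> S2" for b1 b2 \<sigma>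
  proof -
    define c where "c i = (case i of L1 \<Rightarrow> b1 | L2 \<Rightarrow> b2 | L3 \<Rightarrow> id)" for i
    define c' where "c' i = inv_into UNIV (c (inv_into UNIV \<sigma> i))" for i
    have p: "c i permutes {L1, L2, L3}" for i
      using b by (cases i) (auto simp: c_def S3_def permutes_id)
    have \<sigma>: "inv_into UNIV \<sigma> (\<sigma> x) = x" "\<sigma> (inv_into UNIV \<sigma> x) = x" for x
      using s permutes_inverses[of \<sigma>] by (auto simp: S2_def)
    have s3: "\<sigma> L3 = L3" using s by (auto simp: S2_def permutes_def)
    then have s3': "inv_into UNIV \<sigma> L3 = L3" using \<sigma>(1)[of L3] by simp
    have cd: "c L1 = b1" "c L2 = b2" by (auto simp: c_def)
    have "directed_aut (c' L1) (c' L2) (inv_into UNIV \<sigma>) (directed_aut (c L1) (c L2) \<sigma> w) = w" for w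
      by (intro directed_aut_inv) (simp_all add: c'_def \<sigma> s3 permutes_inverses[OF p])
    moreover have "directed_aut (c L1) (c L2) \<sigma> (directed_aut (c' L1) (c' L2) (inv_into UNIV \<sigma>) w) = w" for w
      by (intro directed_aut_inv) (simp_all add: c'_def \<sigma> s3' permutes_inverses[OF p])
    ultimately show ?thesis
      unfolding cd
      by (intro tree_autI[where h = "directed_aut (c' L1) (c' L2) (inv_into UNIV \<sigma>)"])
        (auto simp: fun_eq_iff directed_aut_snoc)
  qed
  ultimately show ?thesis
    by (auto simp: mother_generators_def)
qed

end

theory Submission
  imports Defs
begin

text \<open>
  Write \<open>w * k\<close> for the automorphism that acts as \<open>k\<close> on the subtree below the vertex \<open>w\<close> and
  fixes everything else; this is \<open>below w k\<close>.  Automorphisms supported below pairwise incomparable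
  vertices commute and are independent, so it suffices to find elements \<open>w\<^sub>n * k\<^sub>n\<close> of the mother
  group with \<open>k\<^sub>n\<close> of infinite order and the \<open>w\<^sub>n\<close> incomparable.  The vertices used are
  \<open>w\<^sub>n = 3\<^sup>n2\<close>.

  Every \<open>k\<^sub>n\<close> is a power of a single \<open>y\<close>.  Let \<open>r\<close> be a 3-cycle and \<open>d = (1, r, d)\<close>; let \<open>s\<close> be the
  rooted transposition of 2 and 3, and let \<open>y = (1, q, q\<^sup>-\<^sup>1)\<close> be the commutator of \<open>s\<close> and
  \<open>d\<close>, where \<open>q\<close> is the product of the rooted \<open>r\<^sup>-\<^sup>1\<close> and \<open>d\<close>.
  Two properties of \<open>y\<close> matter.  It has infinite order: the cube of \<open>q\<close> acts below 3 as the
  product of the rooted \<open>r\<close> and \<open>d\<close>, whose own cube acts below 3 as itself, in the manner of an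
  adding machine.  And \<open>s\<close> inverts \<open>y\<close>, so that the commutator of a power \<open>y\<^sup>m\<close> with \<open>s\<close> is
  \<open>y\<close> to the power \<open>-2m\<close>: commutation with \<open>s\<close> does not leave the powers of \<open>y\<close> and does not
  kill any of them.

  Commutators are what carries an element one level down.  If \<open>a\<close> is a rooted involution and
  \<open>c = (1, c\<^sub>2, c)\<close> is directed, then conjugating \<open>(a, 1, b)\<close> by the transposition of 1 and 3 gives an
  element \<open>(b, 1, a)\<close> of the group, and its commutator with \<open>c\<close> is \<open>3 * [a, c]\<close>, as every other
  coordinate contains a trivial factor (\<open>below_commutator_G3\<close>).  For suitable \<open>a\<close> and
  \<open>c\<^sub>2\<close> the element \<open>g = [a, c]\<close> fixes \<open>w\<^sub>n\<close> and acts as \<open>s\<close> below it.  Suppose now that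
  \<open>z = w\<^sub>n * y\<^sup>m\<close> is in the group.  It is the section at 3 of an element of the group that
  fixes 3 (\<open>ex_lift_G3\<close>), and the commutator of that element with \<open>3 * g\<close> is \<open>3 * [z, g]\<close>, which is
  \<open>y\<close> to the power \<open>-2m\<close> below the vertex \<open>3w\<^sub>n\<close>, the next one (\<open>below_descend_G3\<close>).
  Starting from \<open>2 * y\<close>, all the powers of \<open>y\<close> with exponent \<open>(-2)\<^sup>n\<close> below \<open>w\<^sub>n\<close> are reached
  (\<open>below_spine_G3\<close>); they generate the required subgroup.

  Function composition reads from right to left, unlike the product of the group.
\<close>

section \<open>The mother group as a set of permutations\<close>

lemma S3_iff_bij: "a \<in> S3 \<longleftrightarrow> bij a"
proof -
  have "{L1, L2, L3} = UNIV"
    using letter.exhaust by auto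
  then show ?thesis
    by (simp add: S3_def bij_iff permutes_def)
qed

lemma id_in_S2: "id \<in> S2"
  by (simp add: S2_def permutes_id)

abbreviation G3 :: "(vertex \<Rightarrow> vertex) set" where
  "G3 \<equiv> carrier mother_group"

lemma G3_eq_generate: "G3 = generate tree_aut mother_generators"
  using mother_generators_subset
  by (simp add: mother_group_def carrier_subgroup_generated Int_absorb1)

lemma mult_tree_aut [simp]: "f \<otimes>\<^bsub>tree_aut\<^esub> g = g \<circ> f"
  by (simp add: tree_aut_def)

lemma one_tree_aut [simp]: "\<one>\<^bsub>tree_aut\<^esub> = id"
  by (simp add: tree_aut_def)

lemma bij_tree_aut: "f \<in> carrier tree_aut \<Longrightarrow> bij f"
  by (simp add: tree_aut_def)

lemma inv_tree_aut:
  assumes "f \<in> carrier tree_aut"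
  shows "inv\<^bsub>tree_aut\<^esub> f = inv_into UNIV f"
proof -
  interpret group tree_aut by (rule group_tree_aut)
  have "inv\<^bsub>tree_aut\<^esub> f \<circ> f = id"
    using r_inv[OF assms] by simp
  then show ?thesis
    using l_inv[OF assms] by (intro inv_unique_comp[symmetric]) simp_all
qed

lemma G3_subset: "G3 \<subseteq> carrier tree_aut"
  by (simp add: mother_group_def group.carrier_subgroup_generated_subset group_tree_aut)

lemma bij_G3: "f \<in> G3 \<Longrightarrow> bij f"
  using G3_subset bij_tree_aut by blast

lemma id_G3: "id \<in> G3"
  using generate.one[of tree_aut] by (simp add: G3_eq_generate)

lemma comp_G3: "f \<in> G3 \<Longrightarrow> g \<in> G3 \<Longrightarrow> f \<circ> g \<in> G3"
  using generate.eng[of g tree_aut _ f] by (simp add: G3_eq_generate)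

lemma inv_G3:
  assumes "f \<in> G3"
  shows "inv_into UNIV f \<in> G3"
proof -
  interpret group tree_aut by (rule group_tree_aut)
  show ?thesis
    using generate_m_inv_closed[OF mother_generators_subset] assms G3_subset inv_tree_aut
    by (metis G3_eq_generate subsetD)
qed

lemma rooted_G3: "bij a \<Longrightarrow> rooted_aut a \<in> G3"
  by (auto simp: G3_eq_generate mother_generators_def S3_iff_bij intro!: generate.incl)

lemma directed_G3: "bij a \<Longrightarrow> bij b \<Longrightarrow> directed_aut a b id \<in> G3"
  using id_in_S2
  by (auto simp: G3_eq_generate mother_generators_def S3_iff_bij intro!: generate.incl)

section \<open>Automorphisms supported below a vertex\<close>

definition below :: "vertex \<Rightarrow> (vertex \<Rightarrow> vertex) \<Rightarrow> vertex \<Rightarrow> vertex" where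
  "below w k v = (if take (length w) v = w then w @ k (drop (length w) v) else v)"

lemma below_append [simp]: "below w k (w @ u) = w @ k u"
  by (simp add: below_def)

lemma below_outside: "(\<And>u. v \<noteq> w @ u) \<Longrightarrow> below w k v = v"
  by (metis below_def append_take_drop_id)

lemma below_Cons [simp]:
  "below (x # w) k [] = []"
  "below (x # w) k (y # v) = (if y = x then x # below w k v else y # v)"
  by (auto simp: below_def)

lemma below_Nil [simp]: "below [] k = k"
  by (simp add: below_def fun_eq_iff)

lemma below_comp: "below w k \<circ> below w l = below w (k \<circ> l)"
  by (rule ext) (metis below_append below_outside comp_apply)

lemma below_id: "below w id = id"
  by (rule ext) (metis below_append below_outside id_apply)

text \<open>If \<open>f\<close> carries the subtree below \<open>w\<close> to the one below \<open>w'\<close>, conjugation by \<open>f\<close> carries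
  \<open>w' * k\<close> to an automorphism below \<open>w\<close>, with \<open>k\<close> conjugated by the section \<open>s\<close> of \<open>f\<close> at \<open>w\<close>.\<close>

lemma below_conjugate:
  assumes f: "bij f" and fw: "\<And>u. f (w @ u) = w' @ s u" and s: "\<And>u. s (s' u) = u"
  shows "inv_into UNIV f \<circ> below w' k \<circ> f = below w (s' \<circ> k \<circ> s)"
proof
  fix v
  have inv: "inv_into UNIV f (w' @ u) = w @ s' u" for u
    using fw[of "s' u"] s f by (metis bij_inv_eq_iff)
  show "(inv_into UNIV f \<circ> below w' k \<circ> f) v = below w (s' \<circ> k \<circ> s) v"
  proof (cases "\<exists>u. v = w @ u")
    case True
    then show ?thesis using fw inv by auto
  next
    case False
    have "f v \<noteq> w' @ u" for u
      using False inv[of u] f by (metis bij_inv_eq_iff)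
    then show ?thesis
      using False f by (simp add: below_outside bij_is_inj)
  qed
qed

lemma below_conjugate_G3:
  assumes "f \<in> G3" "below w' k \<in> G3" "\<And>u. f (w @ u) = w' @ s u" "\<And>u. s (s' u) = u"
  shows "below w (s' \<circ> k \<circ> s) \<in> G3"
  using below_conjugate[of f w w' s s' k] assms comp_G3 inv_G3 bij_G3 by metis

lemma below_inverse_G3:
  assumes "below w k \<in> G3" "k \<circ> k' = id" "k' \<circ> k = id"
  shows "below w k' \<in> G3"
proof -
  have "inv_into UNIV (below w k) = below w k'"
    using assms by (intro inv_unique_comp) (simp_all add: below_comp below_id)
  then show ?thesis
    using inv_G3[OF assms(1)] by simp
qed

section \<open>Lifting elements and commutators to the third subtree\<close>

lemma rooted_id [simp]: "rooted_aut id u = u"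
  by (cases u) auto

lemma directed_cancel:
  assumes "\<And>x. b1 (b1' x) = x" "\<And>x. b2 (b2' x) = x"
  shows "directed_aut b1 b2 id (directed_aut b1' b2' id u) = u"
proof (induction u)
  case (Cons x u)
  then show ?case by (cases x) (simp_all add: assms rooted_aut_inv)
qed simp

text \<open>The group is self-replicating at 3.  The elements with a lift form a subgroup, so only
  generators need one: a directed automorphism lifts to itself, and the rooted \<open>a\<close> is the first
  section of \<open>(a, 1, b)\<close>, moved to position 3 by a transposition.\<close>

lemma ex_lift_G3:
  assumes "z \<in> G3"
  shows "\<exists>f\<in>G3. \<forall>u. f (L3 # u) = L3 # z u"
proof -
  let ?P = "\<lambda>z. \<exists>f\<in>G3. \<forall>u. f (L3 # u) = L3 # z u"
  have gen: "?P h" if h: "h \<in> mother_generators" for h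
    using h unfolding mother_generators_def
  proof
    assume "h \<in> rooted_aut ` S3"
    then obtain a where a: "bij a" "h = rooted_aut a"
      by (auto simp: S3_iff_bij)
    let ?t = "rooted_aut (transpose L1 L3)"
    have "?t \<circ> directed_aut a id id \<circ> ?t \<in> G3"
      using a by (intro comp_G3 rooted_G3 directed_G3) auto
    moreover have "(?t \<circ> directed_aut a id id \<circ> ?t) (L3 # u) = L3 # h u" for u
      using a by simp
    ultimately show ?thesis by blast
  next
    assume "h \<in> {directed_aut b1 b2 \<sigma> |b1 b2 \<sigma>. b1 \<in> S3 \<and> b2 \<in> S3 \<and> \<sigma> \<in> S2}"
    then obtain b1 b2 \<sigma> where h: "h = directed_aut b1 b2 \<sigma>" and s: "\<sigma> \<in> S2" by blast
    have "\<sigma> L3 = L3"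
      using s by (auto simp: S2_def permutes_def)
    then have "\<forall>u. h (L3 # u) = L3 # h u"
      by (simp add: h)
    moreover have "h \<in> G3"
      using that by (simp add: G3_eq_generate generate.incl)
    ultimately show ?thesis by blast
  qed
  from assms have "z \<in> generate tree_aut mother_generators"
    by (simp add: G3_eq_generate)
  then show ?thesis
  proof (induction rule: generate.induct)
    case one
    show ?case using id_G3 by (intro bexI[of _ id]) simp_all
  next
    case (incl h)
    then show ?case using gen by blast
  next
    case (inv h)
    then obtain f where f: "f \<in> G3" "\<forall>u. f (L3 # u) = L3 # h u" using gen by blast
    have h: "h \<in> carrier tree_aut" using inv mother_generators_subset by blast
    have "inv_into UNIV f (L3 # u) = L3 # inv_into UNIV h u" for u
      using f bij_G3 bij_tree_aut[OF h] by (metis bij_inv_eq_iff)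
    then show ?case
      using f inv_G3 inv_tree_aut[OF h] by metis
  next
    case (eng h1 h2)
    then obtain f1 f2 where "f1 \<in> G3" "\<forall>u. f1 (L3 # u) = L3 # h1 u"
      "f2 \<in> G3" "\<forall>u. f2 (L3 # u) = L3 # h2 u" by blast
    then show ?case
      by (intro bexI[of _ "f2 \<circ> f1"]) (auto intro: comp_G3)
  qed
qed

text \<open>The source of elements supported below one vertex.  The automorphisms \<open>(b, 1, a)\<close> and
  \<open>(1, c\<^sub>2, c)\<close> commute in their first two coordinates, and in the third their commutator is that of
  the rooted \<open>a\<close> and the directed \<open>c\<close>.\<close>

lemma below_commutator_G3:
  assumes a: "\<And>x. a (a x) = x" and c: "\<And>x. c (c' x) = x" "\<And>x. c' (c x) = x"
  shows "below [L3] (rooted_aut a \<circ> directed_aut id c id \<circ> rooted_aut a \<circ> directed_aut id c' id) \<in> G3"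
proof -
  let ?t = "rooted_aut (transpose L1 L3)"
  define B where "B = directed_aut a id id"
  define A where "A = ?t \<circ> B \<circ> ?t"
  define C where "C = directed_aut id c id"
  define C' where "C' = directed_aut id c' id"
  have bij: "bij a" "bij c" "bij c'"
    using a c by (auto intro: involuntory_imp_bij o_bij[of c' c] o_bij[of c c'] simp: fun_eq_iff)
  have BB: "B (B u) = u" for u
    unfolding B_def using a by (simp add: directed_cancel)
  have CC: "C (C' u) = u" for u
    unfolding C_def C'_def using c by (simp add: directed_cancel)
  have "A \<circ> C \<circ> A \<circ> C' \<in> G3"
    unfolding A_def B_def C_def C'_def using bij by (intro comp_G3 rooted_G3 directed_G3) auto
  moreover have "A \<circ> C \<circ> A \<circ> C' = below [L3] (rooted_aut a \<circ> C \<circ> rooted_aut a \<circ> C')"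
  proof
    fix v show "(A \<circ> C \<circ> A \<circ> C') v = below [L3] (rooted_aut a \<circ> C \<circ> rooted_aut a \<circ> C') v"
    proof (cases v)
      case Nil
      then show ?thesis by (simp add: A_def B_def C_def C'_def)
    next
      case (Cons x u)
      have A: "A (L1 # u) = L1 # B u" "A (L2 # u) = L2 # u" "A (L3 # u) = L3 # rooted_aut a u" for u
        by (simp_all add: A_def B_def)
      have C: "C (L1 # u) = L1 # u" "C (L2 # u) = L2 # rooted_aut c u" "C (L3 # u) = L3 # C u" for u
        by (simp_all add: C_def)
      have C': "C' (L1 # u) = L1 # u" "C' (L2 # u) = L2 # rooted_aut c' u" "C' (L3 # u) = L3 # C' u" for u
        by (simp_all add: C'_def)
      show ?thesis
        using Cons c(1) by (cases x) (simp_all add: A C C' BB rooted_aut_inv)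
    qed
  qed
  ultimately show ?thesis unfolding C_def C'_def by simp
qed

text \<open>One step down the tree: the commutator \<open>[z, g]\<close> of \<open>z = w * k\<close> with an automorphism \<open>g\<close> that
  acts as \<open>s\<close> below \<open>w\<close> is \<open>w * [k, s]\<close>, and since \<open>s\<close> inverts \<open>k\<close> this is the square of the inverse
  \<open>k'\<close> of \<open>k\<close>.  Since \<open>3 * g\<close> is in the group, commuting it with a lift of \<open>z\<close> moves the result below 3.\<close>

lemma below_descend_G3:
  assumes g: "g \<in> G3" "below [L3] g \<in> G3" and gw: "\<And>u. g (w @ u) = w @ s u"
    and z: "below w k \<in> G3" and s: "\<And>u. s (s u) = u"
    and k: "k' \<circ> k = id" "k \<circ> k' = id" and conj: "s \<circ> k \<circ> s = k'"
  shows "below (L3 # w) (k' \<circ> k') \<in> G3"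
proof -
  let ?z = "below w k"
  have zz: "below w k' \<circ> ?z = id" "?z \<circ> below w k' = id"
    using k by (simp_all add: below_comp below_id)
  obtain f where f: "f \<in> G3" "\<And>u. f (L3 # u) = L3 # ?z u"
    using ex_lift_G3[OF z] by blast
  have bg: "bij g" using g bij_G3 by blast
  have G': "below [L3] (inv_into UNIV g) \<in> G3"
    using bg by (intro below_inverse_G3[OF g(2)])
      (simp_all add: fun_eq_iff bij_is_inj bij_is_surj surj_f_inv_f)
  have "below [L3] (below w k' \<circ> inv_into UNIV g \<circ> ?z) \<in> G3"
    by (rule below_conjugate_G3[OF f(1) G']) (use f zz in \<open>auto simp: fun_eq_iff\<close>)
  then have "below [L3] (below w k' \<circ> inv_into UNIV g \<circ> ?z) \<circ> below [L3] g \<in> G3"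
    using g comp_G3 by blast
  also have "below [L3] (below w k' \<circ> inv_into UNIV g \<circ> ?z) \<circ> below [L3] g
      = below [L3] (below w k' \<circ> (inv_into UNIV g \<circ> ?z \<circ> g))"
    by (simp add: below_comp comp_assoc)
  also have "inv_into UNIV g \<circ> ?z \<circ> g = below w k'"
    using below_conjugate[OF bg gw, of s k] s conj by simp
  also have "below [L3] (below w k' \<circ> below w k') = below (L3 # w) (k' \<circ> k')"
  proof
    fix v show "below [L3] (below w k' \<circ> below w k') v = below (L3 # w) (k' \<circ> k') v"
      by (cases v) (auto simp: below_comp)
  qed
  finally show ?thesis .
qed

section \<open>An automorphism of infinite order inverted by an involution\<close>

fun rot :: "letter \<Rightarrow> letter" where
  "rot L1 = L2" | "rot L2 = L3" | "rot L3 = L1"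

fun rot' :: "letter \<Rightarrow> letter" where
  "rot' L1 = L3" | "rot' L2 = L1" | "rot' L3 = L2"

lemma rot_rot' [simp]: "rot (rot' x) = x" "rot' (rot x) = x"
  by (cases x; simp)+

definition flip :: "vertex \<Rightarrow> vertex" where
  "flip = rooted_aut (transpose L2 L3)"

text \<open>The automorphism \<open>(1, q, q\<^sup>-\<^sup>1)\<close> whose section \<open>q\<close> at 2 is a variant of the odometer below.  As a
  commutator of the involution \<open>flip\<close>, it is inverted by \<open>flip\<close>; as a commutator of a rooted and a
  directed automorphism, it can be put below 3.\<close>

definition paired_odometer :: "vertex \<Rightarrow> vertex" where
  "paired_odometer = flip \<circ> directed_aut id rot id \<circ> flip \<circ> directed_aut id rot' id"

lemma funpow_semiconj:
  assumes "\<And>u. f (h u) = h (g u)"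
  shows "(f ^^ n) (h u) = h ((g ^^ n) u)"
  by (induction n) (simp_all add: assms)

lemma rot_cube [simp]: "rot (rot (rot x)) = x"
  by (cases x) auto

text \<open>Stated at 3 because that is the letter at which the cube of the odometer reproduces it.\<close>

lemma rot_funpow_fixes: "(rot ^^ n) L3 = L3 \<Longrightarrow> 3 dvd n"
proof (induction n rule: less_induct)
  case (less n)
  show ?case
  proof (cases "n < 3")
    case True
    then have "n = 0 \<or> n = 1 \<or> n = 2" by auto
    then show ?thesis using less.prems by (auto simp: numeral_2_eq_2)
  next
    case False
    then obtain m where m: "n = m + 3" by (metis add.commute le_Suc_ex not_less)
    have "(rot ^^ n) L3 = (rot ^^ m) L3"
      by (simp add: m funpow_add numeral_3_eq_3)
    then show ?thesis using less m by (simp)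
  qed
qed

definition odometer :: "vertex \<Rightarrow> vertex" where
  "odometer = directed_aut id rot id \<circ> rooted_aut rot"

text \<open>Along the orbit of 3 under \<open>rot\<close>, the directed factor contributes the sections \<open>1\<close>, \<open>rot\<close> and
  itself, in this order.  The product of the last two is the odometer again, not merely a
  conjugate of it; this is why the orbit is started at 3.\<close>

lemma odometer_cube: "(odometer ^^ 3) (L3 # u) = L3 # odometer u"
  by (simp add: odometer_def numeral_3_eq_3)

text \<open>Infinite descent: a power that is trivial permutes the first letters trivially, so its
  exponent is \<open>3j\<close>, and below 3 it acts as the \<open>j\<close>-th power, which is then trivial as well.\<close>

lemma odometer_infinite_order: "odometer ^^ n = id \<Longrightarrow> n = 0"
proof (induction n rule: less_induct)
  case (less n)
  have hd: "odometer v \<noteq> [] \<and> hd (odometer v) = rot (hd v)" if "v \<noteq> []" for v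
  proof (cases v)
    case (Cons x u)
    then show ?thesis by (cases x) (auto simp: odometer_def)
  qed (use that in simp)
  have "(odometer ^^ m) [L3] \<noteq> [] \<and> hd ((odometer ^^ m) [L3]) = (rot ^^ m) L3" for m
    by (induction m) (use hd in auto)
  from this[of n] have "(rot ^^ n) L3 = L3"
    using less.prems by simp
  then obtain j where j: "n = 3 * j"
    using rot_funpow_fixes by (auto elim: dvdE)
  have "L3 # (odometer ^^ j) u = L3 # u" for u
  proof -
    have "((odometer ^^ 3) ^^ j) (L3 # u) = L3 # (odometer ^^ j) u"
      by (rule funpow_semiconj) (rule odometer_cube)
    moreover have "(odometer ^^ 3) ^^ j = id"
      using less.prems unfolding funpow_mult j by (simp only: mult.commute)
    ultimately show ?thesis by simp
  qed
  then have "odometer ^^ j = id" by auto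
  then show ?case using less.IH[of j] j by (cases "j = 0") auto
qed

lemma paired_odometer_infinite_order:
  assumes "paired_odometer ^^ n = id"
  shows "n = 0"
proof -
  define q where "q = directed_aut id rot id \<circ> rooted_aut rot'"
  have "paired_odometer (L2 # u) = L2 # q u" for u
    by (simp add: paired_odometer_def flip_def q_def)
  then have "(q ^^ n) u = u" for u
    using funpow_semiconj[of paired_odometer "(#) L2" q n u] assms by simp
  then have q: "q ^^ n = id" by auto
  (* Starting at 3, the inverse rotation visits 2 and then 1, so that the sections
     along the orbit are rot, 1 and the directed factor: the product is the odometer. *)
  have q3: "(q ^^ 3) (L3 # u) = L3 # odometer u" for u
    by (simp add: q_def odometer_def numeral_3_eq_3)
  have "((q ^^ 3) ^^ n) = id"
    using q unfolding funpow_mult by (metis funpow_mult id_funpow mult.commute)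
  then have "(odometer ^^ n) u = u" for u
    using funpow_semiconj[of "q ^^ 3" "(#) L3" odometer n u, OF q3] by simp
  then show ?thesis
    using odometer_infinite_order[of n] by (simp add: fun_eq_iff)
qed


lemma flip_flip [simp]: "flip (flip u) = u"
  by (simp add: flip_def rooted_aut_inv)

lemma flip_comp [simp]: "flip \<circ> flip = id"
  by (simp add: fun_eq_iff)

lemma flip_G3: "flip \<in> G3"
  by (simp add: flip_def rooted_G3)

lemma bij_rot: "bij rot" and bij_rot': "bij rot'"
  by (auto intro: o_bij[of rot' rot] o_bij[of rot rot'] simp: fun_eq_iff)

lemma paired_odometer_G3: "paired_odometer \<in> G3"
  unfolding paired_odometer_def by (intro comp_G3 flip_G3 directed_G3 bij_rot bij_rot' bij_id)

lemma flip_inverts_paired_odometer: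
  "(flip \<circ> paired_odometer \<circ> flip) \<circ> paired_odometer = id"
  "paired_odometer \<circ> (flip \<circ> paired_odometer \<circ> flip) = id"
  by (simp_all add: paired_odometer_def fun_eq_iff directed_cancel)

definition ppow :: "int \<Rightarrow> vertex \<Rightarrow> vertex" where
  "ppow i = paired_odometer [^]\<^bsub>tree_aut\<^esub> i"

lemma ppow_0 [simp]: "ppow 0 = id"
  by (simp add: ppow_def)

lemma ppow_1 [simp]: "ppow 1 = paired_odometer"
  using G3_subset paired_odometer_G3 by (auto simp: ppow_def group.int_pow_1 group_tree_aut)

lemma ppow_add: "ppow (i + j) = ppow i \<circ> ppow j"
  using group.int_pow_mult[OF group_tree_aut, of paired_odometer j i] G3_subset paired_odometer_G3
  by (auto simp: ppow_def add.commute)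

lemma ppow_cancel [simp]: "ppow i \<circ> ppow (- i) = id" "ppow (- i) \<circ> ppow i = id"
  by (simp_all flip: ppow_add)

lemma ppow_of_nat: "ppow (int n) = paired_odometer ^^ n"
  by (induction n) (simp_all add: ppow_add)

lemma ppow_eq_id_iff: "ppow i = id \<longleftrightarrow> i = 0"
proof
  assume i: "ppow i = id"
  then have "ppow (- i) = id"
    using ppow_cancel(1)[of i] by simp
  with i have "ppow (int (nat \<bar>i\<bar>)) = id"
    by (cases "i \<ge> 0") auto
  then show "i = 0"
    using paired_odometer_infinite_order by (simp only: ppow_of_nat) fastforce
qed simp

lemma ppow_inj: "ppow i = ppow j \<longleftrightarrow> i = j"
proof
  assume "ppow i = ppow j"
  then have "ppow (i + - j) = id"
    by (simp only: ppow_add ppow_cancel)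
  then show "i = j"
    by (simp only: ppow_eq_id_iff)
qed simp

lemma flip_inverts_ppow: "flip \<circ> ppow i \<circ> flip = ppow (- i)"
proof -
  have inv1: "ppow (- 1) = flip \<circ> paired_odometer \<circ> flip"
    using flip_inverts_paired_odometer(1) ppow_cancel(1)[of 1]
    by (metis ppow_1 comp_assoc id_comp comp_id)
  have eq: "flip \<circ> (k \<circ> l) \<circ> flip = (flip \<circ> k \<circ> flip) \<circ> (flip \<circ> l \<circ> flip)" for k l
    by (simp add: fun_eq_iff)
  show ?thesis
  proof (induction i rule: int_induct[where k = 0])
    case base
    show ?case by simp
  next
    case (step1 i)
    have "flip \<circ> ppow (i + 1) \<circ> flip = ppow (- i) \<circ> ppow (- 1)"
      by (simp only: ppow_add eq step1 ppow_1 inv1)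
    also have "\<dots> = ppow (- (i + 1))"
      by (simp flip: ppow_add)
    finally show ?case .
  next
    case (step2 i)
    have "flip \<circ> ppow (i + - 1) \<circ> flip = ppow (- i) \<circ> (flip \<circ> (flip \<circ> paired_odometer \<circ> flip) \<circ> flip)"
      by (simp only: ppow_add eq step2 inv1)
    also have "flip \<circ> (flip \<circ> paired_odometer \<circ> flip) \<circ> flip = ppow 1"
      by (simp add: fun_eq_iff)
    also have "ppow (- i) \<circ> ppow 1 = ppow (- (i - 1))"
      by (simp only: ppow_add[symmetric]) simp
    finally show ?case
      by simp
  qed
qed

section \<open>Powers of the paired odometer below infinitely many incomparable vertices\<close>

definition spine :: "nat \<Rightarrow> vertex" where
  "spine n = replicate n L3 @ [L2]"

lemma spine_simps [simp]: "spine 0 = [L2]" "spine (Suc n) = L3 # spine n"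
  by (simp_all add: spine_def)

lemma below_L2_paired_odometer_G3: "below [L2] paired_odometer \<in> G3"
proof -
  have "below [L3] paired_odometer \<in> G3"
    using below_commutator_G3[of "transpose L2 L3" rot rot'] by (simp add: paired_odometer_def flip_def)
  from below_conjugate_G3[OF flip_G3 this, of "[L2]" id id] show ?thesis
    by (simp add: flip_def)
qed

text \<open>Let \<open>c = (1, s, c)\<close> with \<open>s\<close> the transposition of 2 and 3, so that \<open>c\<close> acts as \<open>s\<close> below
  every vertex \<open>3\<^sup>n2\<close>.  The commutator of \<open>c\<close> with the transposition of 1 and 3 is \<open>(c, 1, c)\<close>,
  which acts as \<open>s\<close> below all these vertices except 2 itself; for 2, the commutator with the
  transposition of 1 and 2 is \<open>(s, s, 1)\<close>.\<close>

lemma ex_flip_below_spine: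
  "\<exists>g\<in>G3. below [L3] g \<in> G3 \<and> (\<forall>u. g (spine n @ u) = spine n @ flip u)"
proof -
  define C where "C = directed_aut id (transpose L2 L3) id"
  define g where "g a = rooted_aut a \<circ> C \<circ> rooted_aut a \<circ> C" for a
  have G: "g a \<in> G3" "below [L3] (g a) \<in> G3" if "\<And>x. a (a x) = x" for a
  proof -
    have "bij a" using that by (rule involuntory_imp_bij)
    then show "g a \<in> G3"
      unfolding g_def C_def by (intro comp_G3 rooted_G3 directed_G3) auto
    show "below [L3] (g a) \<in> G3"
      unfolding g_def C_def using that by (intro below_commutator_G3) auto
  qed
  have C: "C (spine m @ u) = spine m @ flip u" for m u
    by (induction m) (simp_all add: C_def flip_def)
  show ?thesis
  proof (cases n)
    case 0
    have "g (transpose L1 L2) (spine n @ u) = spine n @ flip u" for u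
      by (simp add: 0 g_def C_def flip_def)
    then show ?thesis using G[of "transpose L1 L2"] by auto
  next
    case (Suc m)
    have CL: "C (L1 # u) = L1 # u" "C (L3 # u) = L3 # C u" for u
      by (simp_all add: C_def)
    have "g (transpose L1 L3) (spine n @ u) = spine n @ flip u" for u
      by (simp add: Suc g_def C CL)
    then show ?thesis using G[of "transpose L1 L3"] by auto
  qed
qed

text \<open>Each step down replaces the exponent \<open>m\<close> by \<open>-2m\<close>; what matters is that it stays nonzero.\<close>

lemma below_spine_G3: "below (spine n) (ppow ((-2) ^ n)) \<in> G3"
proof (induction n)
  case 0
  show ?case using below_L2_paired_odometer_G3 by simp
next
  case (Suc n)
  define e :: int where "e = (-2) ^ n"
  obtain g where g: "g \<in> G3" "below [L3] g \<in> G3" "\<And>u. g (spine n @ u) = spine n @ flip u"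
    using ex_flip_below_spine by blast
  have "below (L3 # spine n) (ppow (- e) \<circ> ppow (- e)) \<in> G3"
    using g Suc by (intro below_descend_G3[where g = g and s = flip and k = "ppow e"])
      (simp_all add: e_def flip_inverts_ppow)
  then show ?case
    by (simp add: e_def flip: ppow_add)
qed

lemma below_spine_multiple_G3: "below (spine n) (ppow ((-2) ^ n * j)) \<in> G3"
proof -
  define e :: int where "e = (-2) ^ n"
  have pos: "below (spine n) (ppow e) \<in> G3"
    by (simp add: e_def below_spine_G3)
  then have neg: "below (spine n) (ppow (- e)) \<in> G3"
    by (rule below_inverse_G3) simp_all
  have "below (spine n) (ppow (e * j)) \<in> G3"
  proof (induction j rule: int_induct[where k = 0])
    case base
    show ?case using id_G3 by (simp only: mult_zero_right ppow_0 below_id)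
  next
    case (step1 j)
    then show ?case
      using comp_G3[OF step1(2) pos] by (simp add: below_comp distrib_left flip: ppow_add)
  next
    case (step2 j)
    then show ?case
      using comp_G3[OF step2(2) neg] by (simp add: below_comp right_diff_distrib flip: ppow_add)
  qed
  then show ?thesis by (simp add: e_def)
qed

section \<open>The free abelian subgroup\<close>

text \<open>The simultaneous action of \<open>k n\<close> below \<open>3\<^sup>n2\<close> for every \<open>n\<close>, that is, the possibly infinite
  product of the commuting automorphisms \<open>below (spine n) (k n)\<close>.  The recursion through the shifted
  sequence makes it multiplicative in \<open>k\<close> with no need to order the factors.\<close>

fun spread :: "(nat \<Rightarrow> vertex \<Rightarrow> vertex) \<Rightarrow> vertex \<Rightarrow> vertex" where
  "spread k [] = []"
| "spread k (L1 # u) = L1 # u"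
| "spread k (L2 # u) = L2 # k 0 u"
| "spread k (L3 # u) = L3 # spread (\<lambda>n. k (Suc n)) u"

lemma spread_comp: "spread k \<circ> spread l = spread (\<lambda>n. k n \<circ> l n)"
proof
  fix u show "(spread k \<circ> spread l) u = spread (\<lambda>n. k n \<circ> l n) u"
    by (induction k u arbitrary: l rule: spread.induct) (simp_all add: comp_def)
qed

lemma spread_id: "spread (\<lambda>_. id) = id"
proof
  fix u show "spread (\<lambda>_. id) u = id u"
  proof (induction u)
    case (Cons x u)
    then show ?case by (cases x) simp_all
  qed simp
qed

lemma spread_spine: "spread k (spine n @ u) = spine n @ k n u"
  by (induction n arbitrary: k) simp_all

lemma spread_single: "spread ((\<lambda>_. id)(n := f)) = below (spine n) f"
proof (induction n)
  case 0
  show ?case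
  proof
    fix u show "spread ((\<lambda>_. id)(0 := f)) u = below (spine 0) f u"
    proof (cases u)
      case (Cons x v)
      then show ?thesis by (cases x) (simp_all add: spread_id)
    qed simp
  qed
next
  case (Suc n)
  show ?case
  proof
    fix u show "spread ((\<lambda>_. id)(Suc n := f)) u = below (spine (Suc n)) f u"
    proof (cases u)
      case (Cons x v)
      have "(\<lambda>m. ((\<lambda>_. id)(Suc n := f)) (Suc m)) = (\<lambda>_. id)(n := f)"
        by auto
      then have "spread ((\<lambda>_. id)(Suc n := f)) (L3 # v) = L3 # below (spine n) f v"
        by (simp only: spread.simps Suc)
      then show ?thesis using Cons by (cases x) simp_all
    qed simp
  qed
qed

text \<open>With finite support, \<open>spread k\<close> is a finite product of its components; the largest index in the
  support is split off first.\<close>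

lemma spread_G3:
  assumes "finite {n. k n \<noteq> id}" "\<And>n. below (spine n) (k n) \<in> G3"
  shows "spread k \<in> G3"
proof -
  have "spread k \<in> G3" if "\<And>n. n \<ge> N \<Longrightarrow> k n = id" "\<And>n. below (spine n) (k n) \<in> G3" for N k
    using that
  proof (induction N arbitrary: k)
    case 0
    then have "k = (\<lambda>_. id)" by blast
    then show ?case using id_G3 by (simp only: spread_id)
  next
    case (Suc N)
    have "spread (k(N := id)) \<in> G3"
      using Suc.prems by (intro Suc.IH) (auto simp: below_id id_G3[unfolded id_def] le_Suc_eq Suc_le_eq)
    then have "spread (k(N := id)) \<circ> below (spine N) (k N) \<in> G3"
      using Suc.prems comp_G3 by blast
    also have "spread (k(N := id)) \<circ> below (spine N) (k N) = spread k"
      unfolding spread_single[symmetric] spread_comp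
      by (rule arg_cong[of _ _ spread]) auto
    finally show ?case .
  qed
  moreover obtain N where "\<And>n. n \<ge> N \<Longrightarrow> k n = id"
    using assms(1) by (metis (mono_tags, lifting) finite_nat_set_iff_bounded mem_Collect_eq not_less)
  ultimately show ?thesis
    using assms(2) by blast
qed

theorem theorem3p10:
  shows "\<exists>L. subgroup L mother_group \<and>
    mother_group\<lparr>carrier := L\<rparr> \<cong> sum_group (UNIV :: nat set) (\<lambda>_. integer_group)"
proof -
  let ?Z = "sum_group (UNIV :: nat set) (\<lambda>_. integer_group)"
  (* The exponents (-2)^n are those for which the powers below the n-th vertex are known to lie
     in the mother group; being nonzero, they do not affect injectivity. *)
  define \<phi> :: "(nat \<Rightarrow> int) \<Rightarrow> vertex \<Rightarrow> vertex"
    where "\<phi> x = spread (\<lambda>n. ppow ((-2) ^ n * x n))" for x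
  have carrier: "carrier ?Z = {x. finite {n. x n \<noteq> 0}}"
    by (simp add: carrier_sum_group PiE_UNIV_domain)
  have mother: "group mother_group"
    by (simp add: mother_group_def group.group_subgroup_generated group_tree_aut)
  have "\<phi> \<in> hom ?Z mother_group"
  proof (rule homI)
    fix x assume "x \<in> carrier ?Z"
    then have "finite {n. ppow ((-2) ^ n * x n) \<noteq> id}"
      by (simp add: carrier ppow_eq_id_iff)
    then show "\<phi> x \<in> G3"
      unfolding \<phi>_def by (rule spread_G3) (rule below_spine_multiple_G3)
  next
    fix x z assume "x \<in> carrier ?Z" "z \<in> carrier ?Z"
    show "\<phi> (x \<otimes>\<^bsub>?Z\<^esub> z) = \<phi> x \<otimes>\<^bsub>mother_group\<^esub> \<phi> z"
      by (simp add: \<phi>_def mother_group_def spread_comp distrib_left add.commute flip: ppow_add)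
  qed
  then interpret group_hom ?Z mother_group \<phi>
    by (simp add: group_hom_def group_hom_axioms_def mother)
  have inj: "inj \<phi>"
  proof (rule injI)
    fix x z assume eq: "\<phi> x = \<phi> z"
    have "ppow ((-2) ^ n * x n) u = ppow ((-2) ^ n * z n) u" for n u
      using fun_cong[OF eq, of "spine n @ u"] by (simp add: \<phi>_def spread_spine)
    then have "(-2) ^ n * x n = (-2) ^ n * z n" for n
      unfolding ppow_inj[symmetric] by blast
    then show "x = z"
      by (simp add: fun_eq_iff)
  qed
  let ?L = "\<phi> ` carrier ?Z"
  have "\<phi> \<in> iso ?Z (mother_group\<lparr>carrier := ?L\<rparr>)"
    using homh inj by (auto simp: iso_def bij_betw_def hom_def intro: inj_on_subset)
  then have "mother_group\<lparr>carrier := ?L\<rparr> \<cong> ?Z"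
    using G.iso_sym is_isoI by blast
  then show ?thesis
    using img_is_subgroup by blast
qed

end
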